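(* Consider the Round-Robin protocol with $n\ge 2$ agents over a finite item set $M$, as described in the context. Let $i\in[n]$ be an agent whose objective $f_i$ is normalized, nonnegative, monotone and submodular, and whose constraint is a cardinality constraint $\mathcal{I}_i=\{S\subseteq M: |S|\le k\}$ for some integer $k\ge 1$. If agent $i$ follows the greedy policy (other agents following arbitrary policies), then the set $S_i$ it builds satisfies $f_i(S_i)\ge \mathrm{OPT}^-_i/n$.
   Context: For $f:2^M\to\mathbb{R}$ write $f(x\,|\,S)=f(S\cup\{x\})-f(S)$; $f$ is submodular if $f(x\,|\,S)\ge f(x\,|\,T)$ whenever $S\subseteq T\subseteq M$, $x\notin T$. Round-Robin protocol: $|M|=m$; initially the available set is $Q=M$; for rounds $r=1,\dots,\lceil m/n\rceil$ and within each round for agents $1,\dots,n$ in order, the current agent (by an arbitrary policy possibly using full information) either selects one item of $Q$, which is removed from $Q$, or selects nothing. Greedy policy of agent $i$: maintain $S_i$ (initially $\emptyset$); at each turn let $A=\{x\in Q: S_i\cup\{x\}\in\mathcal{I}_i\}$; if $A\neq\emptyset$ select some $j\in\arg\max_{x\in A}f_i(x\,|\,S_i)$ and add it to $S_i$, otherwise select nothing. $M_i$ is the set of items still available right before agent $i$'s first turn, and $\mathrm{OPT}^-_i=\max\{f_i(S):S\in\mathcal{I}_i, S\subseteq M_i\}$. *)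

theory Defs
  imports Complex_Main
begin

definition marginal :: "('a set \<Rightarrow> real) \<Rightarrow> 'a \<Rightarrow> 'a set \<Rightarrow> real" where
  "marginal f x S = f (S \<union> {x}) - f S"

definition submodular_on :: "'a set \<Rightarrow> ('a set \<Rightarrow> real) \<Rightarrow> bool" where
  "submodular_on M f \<longleftrightarrow>
     (\<forall>S T x. S \<subseteq> T \<and> T \<subseteq> M \<and> x \<in> M - T \<longrightarrow> marginal f x S \<ge> marginal f x T)"

definition cardinality_constraint :: "'a set \<Rightarrow> nat \<Rightarrow> 'a set set" where
  "cardinality_constraint M k = {S. S \<subseteq> M \<and> card S \<le> k}"

(* A play c records the action c r a of agent a (1..n) in round r (1..rounds M n):
   Some x for selecting item x, None for selecting nothing.  A policy may depend on
   anything, so the outcomes of arbitrary policies are exactly the legal plays. *)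

definition rounds :: "'a set \<Rightarrow> nat \<Rightarrow> nat" where
  "rounds M n = nat \<lceil>real (card M) / real n\<rceil>"

definition available :: "'a set \<Rightarrow> nat \<Rightarrow> (nat \<Rightarrow> nat \<Rightarrow> 'a option) \<Rightarrow> nat \<Rightarrow> nat \<Rightarrow> 'a set" where
  "available M n c r a =
     M - {x. \<exists>r' a'. 1 \<le> r' \<and> a' \<in> {1..n} \<and> (r' < r \<or> r' = r \<and> a' < a) \<and> c r' a' = Some x}"

definition round_robin_play :: "'a set \<Rightarrow> nat \<Rightarrow> (nat \<Rightarrow> nat \<Rightarrow> 'a option) \<Rightarrow> bool" where
  "round_robin_play M n c \<longleftrightarrow>
     (\<forall>r\<in>{1..rounds M n}. \<forall>a\<in>{1..n}. \<forall>x. c r a = Some x \<longrightarrow> x \<in> available M n c r a)"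

(* The items selected by agent i in rounds 1, ..., r. *)
definition selected :: "(nat \<Rightarrow> nat \<Rightarrow> 'a option) \<Rightarrow> nat \<Rightarrow> nat \<Rightarrow> 'a set" where
  "selected c i r = {x. \<exists>r'\<in>{1..r}. c r' i = Some x}"

(* The admissible actions of the greedy policy, given the available items Q and the current set S;
   ties in the argmax are broken arbitrarily. *)
definition greedy_action ::
    "('a set \<Rightarrow> real) \<Rightarrow> 'a set set \<Rightarrow> 'a set \<Rightarrow> 'a set \<Rightarrow> 'a option \<Rightarrow> bool" where
  "greedy_action f \<I> Q S act \<longleftrightarrow>
     (let A = {x \<in> Q. S \<union> {x} \<in> \<I>} in
      if A \<noteq> {} then \<exists>j. act = Some j \<and> is_arg_max (\<lambda>x. marginal f x S) (\<lambda>x. x \<in> A) j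
      else act = None)"

definition follows_greedy ::
    "'a set \<Rightarrow> nat \<Rightarrow> (nat \<Rightarrow> nat \<Rightarrow> 'a option) \<Rightarrow> nat \<Rightarrow> ('a set \<Rightarrow> real) \<Rightarrow> 'a set set \<Rightarrow> bool" where
  "follows_greedy M n c i f \<I> \<longleftrightarrow>
     (\<forall>r\<in>{1..rounds M n}.
        greedy_action f \<I> (available M n c r i) (selected c i (r - 1)) (c r i))"

definition opt_minus ::
    "'a set \<Rightarrow> nat \<Rightarrow> (nat \<Rightarrow> nat \<Rightarrow> 'a option) \<Rightarrow> nat \<Rightarrow> ('a set \<Rightarrow> real) \<Rightarrow> 'a set set \<Rightarrow> real" where
  "opt_minus M n c i f \<I> = Max {f S | S. S \<in> \<I> \<and> S \<subseteq> available M n c 1 i}"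

end

theory Submission imports Defs begin

text \<open>
  Stop agent \<open>i\<close> after the last turn \<open>T\<close> of its initial run of successful turns, with set \<open>S\<close>, and let
  \<open>X = O - S\<close> for an optimal \<open>O\<close>.  Before turn \<open>r + 1\<close> of agent \<open>i\<close> the others have removed at most
  \<open>r * (n - 1)\<close> items of \<open>M\<^sub>i\<close>, and \<open>|X| \<le> T * (n - 1)\<close>.  Hence \<open>X\<close> can be distributed over the turns
  so that each turn receives at most \<open>n - 1\<close> items, all of them available at that turn.  Each such item
  has a marginal value over \<open>S\<close> at most the greedy gain of its turn, so that
  \<open>f O \<le> f S + (n - 1) * f S\<close>.
\<close>

text \<open>A scheduling argument: level \<open>r\<close> may be charged with elements of
  \<open>Q r\<close>, at most \<open>q\<close> of them. Filling the last level first works because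
  the elements barred from it are few enough to fit into the earlier levels.\<close>

lemma sum_le_by_levels:
  fixes w :: "'a \<Rightarrow> real" and d :: "nat \<Rightarrow> real"
  assumes "finite X" and "card X \<le> T * q"
    and "\<And>r. r < T \<Longrightarrow> card (X - Q r) \<le> r * q"
    and "\<And>r x. r < T \<Longrightarrow> x \<in> X \<inter> Q r \<Longrightarrow> w x \<le> d r"
    and "\<And>r. r < T \<Longrightarrow> d r \<ge> 0"
  shows "sum w X \<le> real q * (\<Sum>r<T. d r)"
  using assms
proof (induction T arbitrary: X)
  case 0
  then show ?case by simp
next
  case (Suc T)
  \<comment> \<open>\<open>Y\<close> is what is left to the levels below \<open>T\<close>. It is as
    large as their capacity permits, so that at most \<open>q\<close> elements remain for level
    \<open>T\<close>.\<close>
  have "\<exists>Y. X - Q T \<subseteq> Y \<and> Y \<subseteq> X \<and> card Y = min (card X) (T * q)"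
    using Suc.prems(1) Suc.prems(3)[of T] by (intro exists_subset_between) (auto intro: card_mono)
  then obtain Y where Y: "X - Q T \<subseteq> Y" "Y \<subseteq> X" "card Y = min (card X) (T * q)"
    by blast
  have finY: "finite Y"
    using Y(2) Suc.prems(1) finite_subset by blast
  have "sum w Y \<le> real q * (\<Sum>r<T. d r)"
  proof (rule Suc.IH)
    fix r assume "r < T"
    have "card (Y - Q r) \<le> card (X - Q r)"
      using Y(2) Suc.prems(1) by (intro card_mono) auto
    then show "card (Y - Q r) \<le> r * q"
      using Suc.prems(3)[of r] \<open>r < T\<close> by simp
  qed (use finY Y Suc.prems in auto)
  moreover have "sum w (X - Y) \<le> real q * d T"
  proof -
    have "sum w (X - Y) \<le> real (card (X - Y)) * d T"
      using Suc.prems(4)[of T] Y(1) by (intro sum_bounded_above) auto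
    also have "card (X - Y) \<le> q"
      using Y finY Suc.prems(2) by (simp add: card_Diff_subset)
    then have "real (card (X - Y)) * d T \<le> real q * d T"
      using Suc.prems(5)[of T] by (intro mult_right_mono) auto
    finally show ?thesis .
  qed
  moreover have "sum w X = sum w (X - Y) + sum w Y"
    using Y(2) Suc.prems(1) by (rule sum.subset_diff)
  ultimately show ?case
    by (simp add: distrib_left)
qed

text \<open>Add the elements of \<open>X\<close> one at a time: by diminishing returns each gain is
  at most the gain over \<open>S\<close> alone.\<close>

lemma submodular_union_le:
  assumes "submodular_on M f" and "finite X" and "X \<subseteq> M" and "S \<subseteq> M" and "X \<inter> S = {}"
  shows "f (S \<union> X) \<le> f S + (\<Sum>x\<in>X. marginal f x S)"
  using assms(2,3,5)
proof (induction X rule: finite_induct)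
  case empty
  then show ?case by simp
next
  case (insert x X)
  have "marginal f x (S \<union> X) \<le> marginal f x S"
  proof -
    have "S \<subseteq> S \<union> X" and "S \<union> X \<subseteq> M" and "x \<in> M - (S \<union> X)"
      using assms(4) insert.hyps insert.prems by auto
    then show ?thesis
      using assms(1) unfolding submodular_on_def by blast
  qed
  then show ?case
    using insert by (auto simp: marginal_def)
qed

text \<open>Serves the case in which agent \<open>i\<close> selects an item in every round.\<close>

lemma card_le_rounds:
  assumes "n \<ge> 1"
  shows "card M \<le> n * rounds M n"
proof -
  have "real (card M) / real n \<le> real (rounds M n)"
    unfolding rounds_def by (rule real_nat_ceiling_ge)
  then have "real (card M) \<le> real (n * rounds M n)"
    using assms by (simp add: divide_le_eq mult.commute)
  then show ?thesis
    using of_nat_le_iff by blast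
qed

lemma selected_0 [simp]: "selected c i 0 = {}"
  by (simp add: selected_def)

lemma selected_Suc: "selected c i (Suc r) = selected c i r \<union> {x. c (Suc r) i = Some x}"
  by (auto simp: selected_def atLeastAtMostSuc_conv)

lemma selected_mono: "r \<le> s \<Longrightarrow> selected c i r \<subseteq> selected c i s"
  by (fastforce simp: selected_def)

lemma selected_subset:
  assumes "round_robin_play M n c" and "i \<in> {1..n}" and "r \<le> rounds M n"
  shows "selected c i r \<subseteq> M"
  using assms unfolding round_robin_play_def selected_def available_def by fastforce

lemma available_not_selected:
  assumes "i \<in> {1..n}" and "x \<in> available M n c (Suc r) i"
  shows "x \<notin> selected c i r"
  using assms by (auto simp: available_def selected_def)

text \<open>Between two consecutive turns of agent \<open>i\<close> every other agent has exactly one turn: agents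
  \<open>a > i\<close> in the same round and agents \<open>a < i\<close> in the next one.\<close>
lemma card_removed_le:
  assumes "i \<in> {1..n}" and "X \<subseteq> available M n c 1 i" and "X \<inter> selected c i r = {}"
  shows "card (X - available M n c (Suc r) i) \<le> r * (n - 1)"
proof -
  \<comment> \<open>A pair \<open>(s, a)\<close> stands for the turn of \<open>a\<close> between
    turns \<open>s\<close> and \<open>s + 1\<close> of agent \<open>i\<close>. An idle turn only
    adds an unspecified value to the image, which is harmless for an upper bound.\<close>
  let ?P = "{1..r} \<times> ({1..n} - {i})"
  let ?g = "\<lambda>(s, a). the (c (if a < i then Suc s else s) a)"
  have "X - available M n c (Suc r) i \<subseteq> ?g ` ?P"
  proof
    fix x assume x: "x \<in> X - available M n c (Suc r) i"
    then have x1: "x \<in> available M n c 1 i"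
      using assms(2) by auto
    with x obtain s a where sa: "1 \<le> s" "a \<in> {1..n}" "s < Suc r \<or> s = Suc r \<and> a < i" "c s a = Some x"
      by (auto simp: available_def)
    have "a \<noteq> i"
    proof
      assume "a = i"
      then have "x \<in> selected c i r"
        using sa by (auto simp: selected_def)
      then show False
        using x assms(3) by blast
    qed
    \<comment> \<open>Such a turn precedes the first turn of \<open>i\<close>, when \<open>x\<close>
      was still available. Hence \<open>s - 1\<close> below is at least 1.\<close>
    have "\<not> (s = 1 \<and> a < i)"
      using x1 sa by (auto simp: available_def)
    define s' where "s' = (if a < i then s - 1 else s)"
    have "(s', a) \<in> ?P" and "x = ?g (s', a)"
      using sa \<open>a \<noteq> i\<close> \<open>\<not> (s = 1 \<and> a < i)\<close> by (auto simp: s'_def)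
    then show "x \<in> ?g ` ?P"
      by blast
  qed
  then have "card (X - available M n c (Suc r) i) \<le> card (?g ` ?P)"
    by (intro card_mono) auto
  also have "\<dots> \<le> card ?P"
    by (intro card_image_le) auto
  also have "\<dots> = r * (n - 1)"
    using assms(1) by (simp add: card_cartesian_product)
  finally show ?thesis .
qed

theorem theorem3:
  fixes M :: "'a set" and n i k :: nat
    and f :: "'a set \<Rightarrow> real"
    and c :: "nat \<Rightarrow> nat \<Rightarrow> 'a option"
  assumes "finite M"
    and "n \<ge> 2"
    and "i \<in> {1..n}"
    and normalized: "f {} = 0"
    and nonnegative: "\<forall>S\<subseteq>M. f S \<ge> 0"
    and monotone: "mono_on (Pow M) f"
    and submodular: "submodular_on M f"
    and "k \<ge> 1"
    and "round_robin_play M n c"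
    and "follows_greedy M n c i f (cardinality_constraint M k)"
  shows "f (selected c i (rounds M n))
           \<ge> opt_minus M n c i f (cardinality_constraint M k) / real n"
proof -
  define R where "R = rounds M n"
  define I where "I = cardinality_constraint M k"
  \<comment> \<open>Turns count from 0: \<open>Q r\<close>, \<open>s r\<close> and
    \<open>d r\<close> belong to round \<open>Suc r\<close>, and \<open>S r\<close> is the set held
    just before it.\<close>
  define Q where "Q r = available M n c (Suc r) i" for r
  define S where "S r = selected c i r" for r
  \<comment> \<open>The disjunct \<open>r = R\<close> makes the minimum exist even if no turn
    fails.\<close>
  define T where "T = (LEAST r. r = R \<or> c (Suc r) i = None)"
  define s where "s r = the (c (Suc r) i)" for r
  define d where "d r = marginal f (s r) (S r)" for r
  have T: "T = R \<or> c (Suc T) i = None"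
    unfolding T_def by (rule LeastI[of _ R]) simp
  have "T \<le> R"
    unfolding T_def by (rule Least_le) simp
  have s: "c (Suc r) i = Some (s r)" if "r < T" for r
    using not_less_Least[OF that[unfolded T_def]] by (auto simp: s_def)
  have QM: "Q r \<subseteq> M" for r
    by (auto simp: Q_def available_def)
  have SM: "S r \<subseteq> M" if "r \<le> R" for r
    using selected_subset[OF assms(9,3)] that by (simp add: S_def R_def)
  have finS: "finite (S r)" if "r \<le> R" for r
    using SM that assms(1) finite_subset by blast
  have S_Suc: "S (Suc r) = insert (s r) (S r)" if "r < T" for r
    using s that by (auto simp: S_def selected_Suc)
  have QS: "x \<notin> S r" if "x \<in> Q r" for x r
    using available_not_selected[OF assms(3)] that by (simp add: S_def Q_def)
  have greedy: "greedy_action f I (Q r) (S r) (c (Suc r) i)" if "r < R" for r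
    using bspec[OF assms(10)[unfolded follows_greedy_def], of "Suc r"] that
    by (simp add: I_def Q_def S_def R_def)
  have pick: "s r \<in> Q r \<and> S r \<union> {s r} \<in> I \<and>
      (\<forall>x\<in>Q r. S r \<union> {x} \<in> I \<longrightarrow> marginal f x (S r) \<le> d r)" if "r < T" for r
    using greedy[of r] s[OF that] that \<open>T \<le> R\<close>
    by (auto simp: greedy_action_def is_arg_max_linorder d_def Let_def split: if_splits)
  have cardS: "card (S r) = r" if "r \<le> T" for r
    using that
  proof (induction r)
    case 0
    then show ?case by (simp add: S_def)
  next
    case (Suc r)
    then show ?case
      using S_Suc[of r] QS[of "s r" r] pick[of r] finS[of r] \<open>T \<le> R\<close> by simp
  qed
  have fS: "f (S r) = (\<Sum>j<r. d j)" if "r \<le> T" for r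
    using that
  proof (induction r)
    case 0
    then show ?case using normalized by (simp add: S_def)
  next
    case (Suc r)
    then show ?case
      using S_Suc[of r] by (simp add: d_def marginal_def)
  qed
  \<comment> \<open>The cardinality constraint enters here: below size \<open>k\<close> every
    available item competes in the argmax.\<close>
  have feasible: "S r \<union> {x} \<in> I" if "r < k" "r \<le> T" "x \<in> Q r" for r x
    using that cardS[of r] SM[of r] QM[of r] QS[of x r] finS[of r] \<open>T \<le> R\<close>
    by (auto simp: I_def cardinality_constraint_def)
  have less_k: "r < k" if "r < T" for r
  proof -
    have "card (S (Suc r)) \<le> k"
      using pick[OF that] S_Suc[OF that] by (simp add: I_def cardinality_constraint_def)
    then show ?thesis
      using cardS[of "Suc r"] that by simp
  qed
  have d_nonneg: "d r \<ge> 0" if "r < T" for r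
  proof -
    have "S (Suc r) \<subseteq> M"
      using SM that \<open>T \<le> R\<close> by simp
    then have "f (S r) \<le> f (S (Suc r))"
      using S_Suc[OF that] by (intro mono_onD[OF monotone]) auto
    then show ?thesis
      using S_Suc[OF that] by (simp add: d_def marginal_def)
  qed
  have bound: "f A \<le> real n * f (S T)" if A: "A \<in> I" "A \<subseteq> Q 0" for A
  proof -
    define X where "X = A - S T"
    have AM: "A \<subseteq> M"
      using A(2) QM by blast
    have finA: "finite A"
      using AM assms(1) finite_subset by blast
    \<comment> \<open>\<open>X\<close> avoids \<open>S T\<close>, hence all earlier picks of
      \<open>i\<close>, so only the other agents remove items of \<open>X\<close>.\<close>
    have removed: "card (X - Q r) \<le> r * (n - 1)" if "r \<le> T" for r
      unfolding Q_def
    proof (rule card_removed_le)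
      show "X \<inter> selected c i r = {}"
        using selected_mono[OF that, of c i] by (auto simp: X_def S_def)
    qed (use assms(3) A(2) in \<open>auto simp: X_def Q_def\<close>)
    \<comment> \<open>The run ends for one of three reasons: the rounds are over, so
      \<open>X\<close> lies in the at most \<open>n * T - T\<close> items outside
      \<open>S T\<close>; the bound \<open>k\<close> is reached, so \<open>A\<close> has at most
      \<open>T\<close> items; or no item is left, so all of \<open>X\<close> was removed.\<close>
    have cardX: "card X \<le> T * (n - 1)"
    proof (cases "T = R")
      case True
      have "card X \<le> card (M - S T)"
        using AM assms(1) by (intro card_mono) (auto simp: X_def)
      also have "\<dots> = card M - T"
        using SM[OF \<open>T \<le> R\<close>] finS[OF \<open>T \<le> R\<close>] cardS[of T] by (simp add: card_Diff_subset)
      also have "\<dots> \<le> n * T - T"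
        using card_le_rounds[of n M] assms(2) True by (auto simp: R_def)
      finally show ?thesis
        by (simp add: diff_mult_distrib2 mult.commute)
    next
      case False
      then have "{x \<in> Q T. S T \<union> {x} \<in> I} = {}"
        using greedy[of T] T \<open>T \<le> R\<close>
        by (auto simp: greedy_action_def Let_def split: if_splits)
      then consider "k \<le> T" | "Q T = {}"
        using feasible[of T] by (cases "T < k") auto
      then show ?thesis
      proof cases
        case 1
        have "card X \<le> card A"
          using finA by (intro card_mono) (auto simp: X_def)
        also have "\<dots> \<le> T"
          using A(1) 1 by (simp add: I_def cardinality_constraint_def)
        also have "\<dots> \<le> T * (n - 1)"
          using assms(2) by (cases n) auto
        finally show ?thesis .
      next
        case 2
        then show ?thesis
          using removed[of T] by simp
      qed
    qed
    have "(\<Sum>x\<in>X. marginal f x (S T)) \<le> real (n - 1) * (\<Sum>r<T. d r)"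
    proof (rule sum_le_by_levels[where Q = Q])
      fix r x assume r: "r < T" and x: "x \<in> X \<inter> Q r"
      have "marginal f x (S T) \<le> marginal f x (S r)"
      proof -
        have "S r \<subseteq> S T" and "x \<in> M - S T"
          using selected_mono[of r T c i] r x AM by (auto simp: X_def S_def)
        then show ?thesis
          using submodular SM[OF \<open>T \<le> R\<close>] unfolding submodular_on_def by blast
      qed
      also have "\<dots> \<le> d r"
        using pick[OF r] feasible[of r x] less_k[OF r] r x by auto
      finally show "marginal f x (S T) \<le> d r" .
    qed (use finA cardX removed d_nonneg in \<open>auto simp: X_def\<close>)
    moreover have "f (S T \<union> X) \<le> f (S T) + (\<Sum>x\<in>X. marginal f x (S T))"
      using submodular finA AM SM[OF \<open>T \<le> R\<close>]
      by (intro submodular_union_le) (auto simp: X_def)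
    moreover have "f A \<le> f (S T \<union> X)"
      using AM SM[OF \<open>T \<le> R\<close>] by (intro mono_onD[OF monotone]) (auto simp: X_def)
    ultimately have "f A \<le> f (S T) + real (n - 1) * f (S T)"
      using fS[of T] by simp
    also have "\<dots> = real n * f (S T)"
      using assms(2) by (simp add: of_nat_diff algebra_simps)
    finally show ?thesis .
  qed
  have "opt_minus M n c i f I \<le> real n * f (S T)"
    unfolding opt_minus_def
  proof (rule Max.boundedI)
    have "{f A |A. A \<in> I \<and> A \<subseteq> available M n c 1 i} \<subseteq> f ` Pow M"
      by (auto simp: I_def cardinality_constraint_def)
    then show "finite {f A |A. A \<in> I \<and> A \<subseteq> available M n c 1 i}"
      using assms(1) finite_subset by blast
    show "{f A |A. A \<in> I \<and> A \<subseteq> available M n c 1 i} \<noteq> {}"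
      by (auto simp: I_def cardinality_constraint_def intro: exI[of _ "{}"])
  qed (use bound in \<open>auto simp: Q_def\<close>)
  \<comment> \<open>Whatever the turns after \<open>T\<close> contribute, monotonicity keeps the
    bound.\<close>
  moreover have "f (S T) \<le> f (S R)"
    using SM selected_mono[OF \<open>T \<le> R\<close>, of c i] \<open>T \<le> R\<close>
    by (intro mono_onD[OF monotone]) (auto simp: S_def)
  ultimately have "opt_minus M n c i f I \<le> real n * f (S R)"
    by (meson mult_left_mono of_nat_0_le_iff order_trans)
  then show ?thesis
    using assms(2) by (simp add: I_def S_def R_def divide_le_eq mult.commute)
qed

end
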